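(* Let $q(\mathbf{x};\boldsymbol{\eta})=\sum_{k=1}^K\pi^{(k)}q(\mathbf{x}|\omega=k;\boldsymbol{\eta})$ be a Gaussian mixture density on $\mathbb{R}^n$ with $q(\mathbf{x}|\omega=k;\boldsymbol{\eta})=p_{\mathcal{N}}(\mathbf{x};\boldsymbol{\mu}^{(k)},\Sigma^{(k)})$, $\Sigma^{(k)}\succ 0$, and natural parameters $\boldsymbol{\gamma}^{(k)}=[\Sigma^{(k)}]^{-1}\boldsymbol{\mu}^{(k)}$, $\Gamma^{(k)}=-\frac12[\Sigma^{(k)}]^{-1}$, $\eta_\omega^{(k)}=\log(\pi^{(k)}/\pi^{(K)})$. Let $V(\mathbf{x};\boldsymbol{\eta})=\log q(\mathbf{x};\boldsymbol{\eta})-\log p(\mathbf{x},\mathbf{z})$, where $p(\mathbf{x},\mathbf{z})=p(\mathbf{z}|\mathbf{x})p(\mathbf{x})$ with $\mathbf{z}$ fixed. Let $\boldsymbol{\eta}_t$ evolve according to the approximated Gaussian mixture Fisher-Rao parameter flow: for each $k=1,\dots,K$, $$\frac{d\boldsymbol{\gamma}^{(k)}_t}{dt}=-\mathbb{E}_{q(\mathbf{x}|\omega=k;\boldsymbol{\eta}_t)}\left[\tfrac12\nabla^2_{\mathbf{x}}V(\mathbf{x};\boldsymbol{\eta}_t)[\Gamma^{(k)}_t]^{-1}\boldsymbol{\gamma}^{(k)}_t+\nabla_{\mathbf{x}}V(\mathbf{x};\boldsymbol{\eta}_t)\right],\qquad \frac{d\Gamma^{(k)}_t}{dt}=-\tfrac12\mathbb{E}_{q(\mathbf{x}|\omega=k;\boldsymbol{\eta}_t)}\left[\nabla^2_{\mathbf{x}}V(\mathbf{x};\boldsymbol{\eta}_t)\right],$$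 $$\frac{d[\eta^{(k)}_\omega]_t}{dt}=\mathbb{E}_{q(\mathbf{x}|\omega=K;\boldsymbol{\eta}_t)}[V(\mathbf{x};\boldsymbol{\eta}_t)]-\mathbb{E}_{q(\mathbf{x}|\omega=k;\boldsymbol{\eta}_t)}[V(\mathbf{x};\boldsymbol{\eta}_t)].$$ Then, for each $k$, the induced time rate of change of the $k$-th mixture component satisfies the Liouville equation $$\frac{d\,q(\mathbf{x}|\omega=k;\boldsymbol{\eta}_t)}{dt}=-\nabla_{\mathbf{x}}\cdot\big(q(\mathbf{x}|\omega=k;\boldsymbol{\eta}_t)\,\tilde\phi_k(\mathbf{x},t)\big)$$ with particle dynamics function $\tilde\phi_k(\mathbf{x},t)=\tilde A^{(k)}_t\mathbf{x}+\tilde{\mathbf{b}}^{(k)}_t$, where $$\tilde A^{(k)}_t=\tfrac14[\Gamma^{(k)}_t]^{-1}\mathbb{E}_{q(\mathbf{x}|\omega=k;\boldsymbol{\eta}_t)}\left[\nabla^2_{\mathbf{x}}V(\mathbf{x};\boldsymbol{\eta}_t)\right],$$ $$\tilde{\mathbf{b}}^{(k)}_t=\tfrac12[\Gamma^{(k)}_t]^{-1}\mathbb{E}_{q(\mathbf{x}|\omega=k;\boldsymbol{\eta}_t)}\left[\nabla_{\mathbf{x}}V(\mathbf{x};\boldsymbol{\eta}_t)\right]+\tfrac12\tilde A^{(k)}_t[\Gamma^{(k)}_t]^{-1}\boldsymbol{\gamma}^{(k)}_t.$$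
   Context: $p_{\mathcal{N}}(\cdot;\boldsymbol{\mu},\Sigma)$ is the Gaussian density with mean $\boldsymbol{\mu}$ and covariance $\Sigma$; weights satisfy $\pi^{(k)}>0$, $\sum_k\pi^{(k)}=1$. $\nabla_{\mathbf{x}}$, $\nabla^2_{\mathbf{x}}$, $\nabla_{\mathbf{x}}\cdot$ are gradient, Hessian and divergence in $\mathbf{x}$. It is implicitly assumed that $p(\mathbf{x},\mathbf{z})>0$ is twice continuously differentiable in $\mathbf{x}$, the Gaussian expectations are finite, and the flow is considered on a time interval on which a solution with $\Gamma^{(k)}_t$ negative definite exists. *)

theory Defs
  imports "HOL-Analysis.Analysis"
begin

definition pos_def_matrix :: "real^'n^'n \<Rightarrow> bool" where
  "pos_def_matrix A \<longleftrightarrow> transpose A = A \<and> (\<forall>x. x \<noteq> 0 \<longrightarrow> 0 < x \<bullet> (A *v x))"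

definition gaussian_density :: "real^'n \<Rightarrow> real^'n^'n \<Rightarrow> real^'n \<Rightarrow> real" where
  "gaussian_density \<mu> \<Sigma> x =
     exp (- (1/2) * ((x - \<mu>) \<bullet> (matrix_inv \<Sigma> *v (x - \<mu>)))) / sqrt ((2 * pi) ^ CARD('n) * det \<Sigma>)"

definition gaussian_measure :: "real^'n \<Rightarrow> real^'n^'n \<Rightarrow> (real^'n) measure" where
  "gaussian_measure \<mu> \<Sigma> = density lborel (\<lambda>x. ennreal (gaussian_density \<mu> \<Sigma> x))"

definition gaussian_mixture_density ::
    "nat \<Rightarrow> (nat \<Rightarrow> real) \<Rightarrow> (nat \<Rightarrow> real^'n) \<Rightarrow> (nat \<Rightarrow> real^'n^'n) \<Rightarrow> real^'n \<Rightarrow> real" where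
  "gaussian_mixture_density K w \<mu> \<Sigma> x = (\<Sum>k = 1..K. w k * gaussian_density (\<mu> k) (\<Sigma> k) x)"

definition gradient :: "(real^'n \<Rightarrow> real) \<Rightarrow> real^'n \<Rightarrow> real^'n" where
  "gradient f x = (\<chi> i. frechet_derivative f (at x) (axis i 1))"

definition hessian :: "(real^'n \<Rightarrow> real) \<Rightarrow> real^'n \<Rightarrow> real^'n^'n" where
  "hessian f x = jacobian (gradient f) (at x)"

definition divergence :: "(real^'n \<Rightarrow> real^'n) \<Rightarrow> real^'n \<Rightarrow> real" where
  "divergence F x = trace (jacobian F (at x))"

(* Continuity of the gradient is implied by its differentiability. *)
definition twice_continuously_differentiable :: "(real^'n \<Rightarrow> real) \<Rightarrow> bool" where
  "twice_continuously_differentiable f \<longleftrightarrow>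
     f differentiable_on UNIV \<and> gradient f differentiable_on UNIV \<and> continuous_on UNIV (hessian f)"

end

theory Submission
  imports Defs
begin

text \<open>For a fixed component put \<open>P = \<Sigma>\<^sup>-\<^sup>1 = -2\<Gamma>\<close>, \<open>H = E[\<nabla>\<^sup>2V]\<close> and \<open>g = E[\<nabla>V]\<close>. The flow says \<open>P' = H\<close>
  and, differentiating \<open>P\<mu> = \<gamma>\<close>, \<open>\<mu>' = -\<Sigma>g\<close>; the particle dynamics is
  \<open>\<phi>(x) = -(1/2)\<Sigma>Hy - \<Sigma>g\<close> with \<open>y = x - \<mu>\<close>. Jacobi's formula for \<open>(det P)'\<close> and \<open>\<nabla>q = -q Py\<close> show that
  both sides of the Liouville equation equal \<open>q (tr(\<Sigma>H)/2 - y\<bullet>g - y\<bullet>Hy/2)\<close>.\<close>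

section \<open>Linearity of matrix products, scaling and the trace\<close>

lemma bounded_bilinear_matrix_vector_mult:
  "bounded_bilinear (\<lambda>(A :: real^'n^'m) x. A *v x)"
  unfolding bilinear_conv_bounded_bilinear[symmetric] bilinear_def
  by (auto intro!: linearI simp: matrix_vector_right_distrib matrix_vector_mult_add_rdistrib
      matrix_vector_mult_scaleR scaleR_matrix_vector_assoc)

lemma bounded_linear_matrix_mult_left:
  "bounded_linear (\<lambda>X :: real^'n^'n. A ** X)"
  unfolding linear_conv_bounded_linear[symmetric]
  by (auto intro!: linearI simp: vec_eq_iff matrix_matrix_mult_def algebra_simps sum.distrib sum_distrib_left)

lemma matrix_mult_scaleR_scaleR:
  "(a *\<^sub>R A) ** (b *\<^sub>R B) = (a * b) *\<^sub>R (A ** (B :: real^'n^'n) :: real^'n^'n)"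
  by (simp add: vec_eq_iff matrix_matrix_mult_def sum_distrib_left mult_ac)

lemma trace_scaleR: "trace (c *\<^sub>R A) = c * trace (A :: real^'n^'n)"
  by (simp add: trace_def sum_distrib_left)

section \<open>The derivative of the determinant\<close>

text \<open>The Leibniz expansion is a polynomial in the entries, so the product rule applies term
  by term. Derivatives are assumed entrywise so that the result also serves the matrices of Cramer's
  rule, whose columns come from two different functions.\<close>

lemma has_derivative_det:
  fixes X :: "'a::real_normed_vector \<Rightarrow> real^'n^'n"
  assumes "\<And>i j. ((\<lambda>x. X x $ i $ j) has_derivative (\<lambda>h. X' h i j)) (at x within S)"
  shows "((\<lambda>x. det (X x)) has_derivative
     (\<lambda>h. \<Sum>p\<in>{p. p permutes UNIV}. of_int (sign p) *
        (\<Sum>i\<in>UNIV. X' h i (p i) * (\<Prod>j\<in>UNIV - {i}. X x $ j $ p j)))) (at x within S)"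
  unfolding det_def by (intro has_derivative_sum has_derivative_mult_right has_derivative_prod assms)

text \<open>A permutation other than the identity moves at least two points, so each of its first-order
  terms at the identity matrix contains a vanishing off-diagonal entry.\<close>
lemma has_derivative_det_mat_1:
  "(det has_derivative (trace :: real^'n^'n \<Rightarrow> real)) (at (mat 1) within S)"
proof -
  have comp: "((\<lambda>M :: real^'n^'n. M $ i $ j) has_derivative (\<lambda>h. h $ i $ j)) (at (mat 1) within S)" for i j
    by (intro bounded_linear_imp_has_derivative
        bounded_linear_compose[OF bounded_linear_vec_nth bounded_linear_vec_nth])
  have "(\<Sum>p\<in>{p. p permutes UNIV}. of_int (sign p) *
          (\<Sum>i\<in>UNIV. h $ i $ p i * (\<Prod>j\<in>UNIV - {i}. (mat 1 :: real^'n^'n) $ j $ p j)))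
        = trace h" (is "sum ?f ?P = _") for h :: "real^'n^'n"
  proof -
    have zero: "?f p = 0" if "p \<in> ?P - {id}" for p
    proof -
      have perm: "p permutes UNIV" and "p \<noteq> id"
        using that by auto
      then obtain a where a: "p a \<noteq> a"
        by (auto simp: fun_eq_iff)
      then have pa: "p (p a) \<noteq> p a"
        using permutes_inj[OF perm] by (auto dest: injD)
      have prod0: "(\<Prod>j\<in>UNIV - {i}. (mat 1 :: real^'n^'n) $ j $ p j) = 0" for i
      proof (rule prod_zero)
        show "\<exists>j\<in>UNIV - {i}. (mat 1 :: real^'n^'n) $ j $ p j = 0"
          \<comment> \<open>Deleting index \<open>i\<close> removes only one of the two moved points
            \<open>a\<close> and \<open>p a\<close>; the other one still contributes an off-diagonal
            zero.\<close>
          using a pa by (cases "i = a") (auto simp: mat_def intro: bexI[of _ "p a"] bexI[of _ a])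
      qed simp
      show ?thesis
        by (simp only: prod0 mult_zero_right sum.neutral_const)
    qed
    have "sum ?f ?P = sum ?f {id}"
      by (rule sum.mono_neutral_right) (use zero permutes_id in auto)
    also have "\<dots> = trace h"
      by (simp add: trace_def mat_def)
    finally show ?thesis .
  qed
  with has_derivative_det[OF comp] show ?thesis
    by (simp add: fun_eq_iff)
qed

lemma matrix_inv_cancel:
  fixes A :: "real^'n^'n"
  assumes "invertible A"
  shows "A ** matrix_inv A = mat 1" "matrix_inv A ** A = mat 1"
proof -
  from assms obtain B where "A ** B = mat 1 \<and> B ** A = mat 1"
    by (auto simp: invertible_def)
  then show "A ** matrix_inv A = mat 1" "matrix_inv A ** A = mat 1"
    unfolding matrix_inv_def by (metis (mono_tags, lifting) someI_ex)+
qed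

text \<open>A right inverse of a square matrix is two-sided and hence unique, which pins down the
  inverse that \<open>matrix_inv\<close> picks by choice.\<close>

lemma matrix_inv_eqI:
  fixes A :: "real^'n^'n"
  assumes "A ** B = mat 1"
  shows "matrix_inv A = B"
proof -
  have "invertible A"
    using assms by (auto simp: invertible_right_inverse)
  then show ?thesis
    by (metis assms matrix_inv_cancel(2) matrix_mul_assoc matrix_mul_lid matrix_mul_rid)
qed

text \<open>Jacobi's formula. Multiplying \<open>X s\<close> by the fixed matrix
  \<open>matrix_inv (X t)\<close> moves the base point to the identity, where the derivative of
  \<open>det\<close> is the trace; multiplicativity of \<open>det\<close> then restores the factor
  \<open>det (X t)\<close>.\<close>

lemma has_real_derivative_det:
  fixes X :: "real \<Rightarrow> real^'n^'n"
  assumes X: "(X has_vector_derivative X') (at t within T)" and inv: "invertible (X t)"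
  shows "((\<lambda>s. det (X s)) has_real_derivative det (X t) * trace (matrix_inv (X t) ** X')) (at t within T)"
proof -
  let ?B = "matrix_inv (X t)"
  have "((\<lambda>s. ?B ** X s) has_vector_derivative ?B ** X') (at t within T)"
    by (rule bounded_linear.has_vector_derivative[OF bounded_linear_matrix_mult_left X])
  then have "((\<lambda>s. ?B ** X s) has_derivative (\<lambda>h. h *\<^sub>R (?B ** X'))) (at t within T)"
    by (simp add: has_vector_derivative_def)
  then have "((\<lambda>s. det (?B ** X s)) has_derivative (\<lambda>h. trace (h *\<^sub>R (?B ** X')))) (at t within T)"
    by (rule has_derivative_compose) (simp add: matrix_inv_cancel(2)[OF inv] has_derivative_det_mat_1)
  then have "((\<lambda>s. det (?B ** X s)) has_real_derivative trace (?B ** X')) (at t within T)"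
    by (simp add: has_field_derivative_def trace_scaleR mult_commute_abs)
  then have "((\<lambda>s. det (X t) * det (?B ** X s)) has_real_derivative det (X t) * trace (?B ** X')) (at t within T)"
    by (rule DERIV_cmult)
  moreover have "det (X t) * det (?B ** X s) = det (X s)" for s
    by (simp add: det_mul[symmetric] matrix_mul_assoc matrix_inv_cancel(1)[OF inv])
  ultimately show ?thesis by simp
qed

section \<open>Inverse matrices and linear systems with moving coefficients\<close>

lemma invertible_matrix_inv:
  fixes A :: "real^'n^'n"
  assumes "invertible A"
  shows "invertible (matrix_inv A)"
  using matrix_inv_cancel[OF assms] by (auto simp: invertible_def)

text \<open>Cramer's rule makes the solution differentiable; differentiating the system then
  identifies the derivative, unless the point is isolated and there is nothing to show.\<close>
lemma has_vector_derivative_linear_system: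
  fixes P :: "real \<Rightarrow> real^'n^'n"
  assumes t: "t \<in> T"
    and P: "(P has_vector_derivative P') (at t within T)"
    and c: "(c has_vector_derivative c') (at t within T)"
    and inv: "\<And>s. s \<in> T \<Longrightarrow> invertible (P s)"
    and sys: "\<And>s. s \<in> T \<Longrightarrow> P s *v v s = c s"
  shows "(v has_vector_derivative matrix_inv (P t) *v (c' - P' *v v t)) (at t within T)"
proof (cases "at t within T = bot")
  case True
  then show ?thesis
    by (simp add: has_vector_derivative_def has_derivative_def bounded_linear_scaleR_left)
next
  case False
  \<comment> \<open>Cramer's numerator matrices: column \<open>k\<close> of \<open>P s\<close> is
    replaced by the right-hand side \<open>c s\<close>.\<close>
  define C where "C k s = (\<chi> i j. if j = k then c s $ i else P s $ i $ j)" for k s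
  have P_comp: "((\<lambda>s. P s $ i $ j) has_derivative (\<lambda>h. h * P' $ i $ j)) (at t within T)" for i j
    using bounded_linear.has_derivative[OF bounded_linear_compose[OF bounded_linear_vec_nth bounded_linear_vec_nth]
        P[unfolded has_vector_derivative_def], of i j] by simp
  have c_comp: "((\<lambda>s. c s $ i) has_derivative (\<lambda>h. h * c' $ i)) (at t within T)" for i
    using bounded_linear.has_derivative[OF bounded_linear_vec_nth c[unfolded has_vector_derivative_def], of i]
    by simp
  have C_comp: "((\<lambda>s. C k s $ i $ j) has_derivative (\<lambda>h. h * (if j = k then c' $ i else P' $ i $ j)))
      (at t within T)" for k i j
    using P_comp c_comp by (simp add: C_def)
  have det_P: "det (P s) \<noteq> 0" if "s \<in> T" for s
    using inv[OF that] by (simp add: invertible_det_nz)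
  \<comment> \<open>Expanding in the standard basis reduces differentiability of the vector to that
    of scalar quotients of determinants.\<close>
  have quot: "(\<lambda>s. \<Sum>k\<in>UNIV. (det (C k s) / det (P s)) *\<^sub>R axis k (1::real)) differentiable (at t within T)"
    using det_P[OF t] has_derivative_det[OF P_comp] has_derivative_det[OF C_comp]
    by (intro differentiable_sum differentiable_scaleR differentiable_divide ballI)
       (auto simp: differentiable_def)
  have v_eq: "v s = (\<Sum>k\<in>UNIV. (det (C k s) / det (P s)) *\<^sub>R axis k 1)" if "s \<in> T" for s
  proof -
    have "v s = (\<chi> k. det (C k s) / det (P s))"
      using cramer[OF det_P[OF that]] sys[OF that] unfolding C_def by blast
    then show ?thesis
      by (simp add: vec_eq_iff axis_def if_distrib cong: if_cong)
  qed
  have "v differentiable (at t within T)"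
    using differentiable_transform_within[OF quot zero_less_one t] v_eq by fastforce
  then obtain v' where v': "(v has_vector_derivative v') (at t within T)"
    using vector_derivative_works by blast
  have "((\<lambda>s. P s *v v s) has_vector_derivative P t *v v' + P' *v v t) (at t within T)"
    by (rule bounded_bilinear.has_vector_derivative[OF bounded_bilinear_matrix_vector_mult P v'])
  then have "(c has_vector_derivative P t *v v' + P' *v v t) (at t within T)"
    by (rule has_vector_derivative_transform[OF t, rotated]) (simp add: sys)
  then have "c' = P t *v v' + P' *v v t"
    using vector_derivative_unique_within[OF False c] by blast
  then have "matrix_inv (P t) *v (c' - P' *v v t) = v'"
    by (simp add: matrix_vector_mul_assoc matrix_inv_cancel(2)[OF inv[OF t]])
  with v' show ?thesis by simp
qed

section \<open>Positive definite and symmetric matrices\<close>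

lemma pos_def_matrix_invertible:
  assumes "pos_def_matrix A"
  shows "invertible A"
proof -
  have "x = 0" if "A *v x = 0" for x
    using assms that unfolding pos_def_matrix_def by fastforce
  then show ?thesis
    unfolding invertible_left_inverse matrix_left_invertible_ker by blast
qed

lemma transpose_matrix_inv:
  fixes A :: "real^'n^'n"
  assumes "invertible A" "transpose A = A"
  shows "transpose (matrix_inv A) = matrix_inv A"
proof (rule matrix_inv_eqI[symmetric])
  show "A ** transpose (matrix_inv A) = mat 1"
    using arg_cong[OF matrix_inv_cancel(2)[OF assms(1)], of transpose]
    by (simp add: matrix_transpose_mul assms(2))
qed

lemma inner_symmetric_matrix:
  fixes A :: "real^'n^'n"
  assumes "transpose A = A"
  shows "x \<bullet> (A *v y) = (A *v x) \<bullet> y"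
  using dot_lmul_matrix[of x A y] vector_transpose_matrix[of x "transpose A"] assms by simp

section \<open>The Gaussian density: derivatives in the parameters and in space\<close>

text \<open>Valid for a negative determinant as well, since \<^const>\<open>sqrt\<close> is odd.\<close>
lemma gaussian_density_precision:
  fixes \<Sigma> :: "real^'n^'n"
  assumes "invertible \<Sigma>"
  shows "gaussian_density \<mu> \<Sigma> x = sqrt (det (matrix_inv \<Sigma>)) / sqrt ((2 * pi) ^ CARD('n)) *
     exp (- (1/2) * ((x - \<mu>) \<bullet> (matrix_inv \<Sigma> *v (x - \<mu>))))"
proof -
  have "det \<Sigma> * det (matrix_inv \<Sigma>) = 1"
    by (simp add: det_mul[symmetric] matrix_inv_cancel(1)[OF assms])
  then have "det (matrix_inv \<Sigma>) = inverse (det \<Sigma>)"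
    by (rule inverse_unique[symmetric])
  then show ?thesis
    by (simp only: gaussian_density_def real_sqrt_mult real_sqrt_inverse divide_inverse
        inverse_mult_distrib mult_ac)
qed

text \<open>The factor multiplying the density is its logarithmic derivative: the trace comes from
  the normalising constant, the other two terms from the motion of the mean and of the precision in
  the exponent. The precision is the differentiated matrix because it is the one the flow controls,
  through \<Gamma>.\<close>

lemma has_real_derivative_gaussian_density_parameters:
  fixes \<Sigma> :: "real \<Rightarrow> real^'n^'n"
  assumes t: "t \<in> T"
    and inv: "\<And>s. s \<in> T \<Longrightarrow> invertible (\<Sigma> s)"
    and sym: "transpose (\<Sigma> t) = \<Sigma> t"
    and \<mu>: "(\<mu> has_vector_derivative \<mu>') (at t within T)"
    and P: "((\<lambda>s. matrix_inv (\<Sigma> s)) has_vector_derivative P') (at t within T)"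
  shows "((\<lambda>s. gaussian_density (\<mu> s) (\<Sigma> s) x) has_real_derivative
     gaussian_density (\<mu> t) (\<Sigma> t) x *
       (trace (\<Sigma> t ** P') / 2 + (matrix_inv (\<Sigma> t) *v (x - \<mu> t)) \<bullet> \<mu>'
        - (x - \<mu> t) \<bullet> (P' *v (x - \<mu> t)) / 2)) (at t within T)"
proof -
  let ?P = "\<lambda>s. matrix_inv (\<Sigma> s)"
  let ?y = "\<lambda>s. x - \<mu> s"
  define N where "N = sqrt ((2 * pi) ^ CARD('n))"
  have N: "N \<noteq> 0"
    by (simp add: N_def)
  define D where "D s = det (?P s)" for s
  define E where "E s = ?y s \<bullet> (?P s *v ?y s)" for s
  have D0: "D t \<noteq> 0"
    using invertible_matrix_inv[OF inv[OF t]] by (simp add: D_def invertible_det_nz)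
  have PP: "matrix_inv (?P t) = \<Sigma> t"
    using matrix_inv_cancel(2)[OF inv[OF t]] by (rule matrix_inv_eqI)
  have D: "(D has_real_derivative D t * trace (\<Sigma> t ** P')) (at t within T)"
    using has_real_derivative_det[OF P invertible_matrix_inv[OF inv[OF t]]]
    unfolding D_def PP .
  have sqrt_D: "((\<lambda>s. sqrt (D s)) has_real_derivative sqrt (D t) * (trace (\<Sigma> t ** P') / 2)) (at t within T)"
  proof -
    \<comment> \<open>The form \<open>sqrt (D t) / (2 * D t)\<close> is correct for either sign of a
      nonzero \<open>D t\<close>. In the chain rule its denominator cancels against the factor
      \<open>D t\<close> from Jacobi's formula, leaving \<open>sqrt (D t)\<close> as a common
      factor.\<close>
    have "(sqrt has_real_derivative sqrt (D t) / (2 * D t)) (at (D t))"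
      by (rule DERIV_real_sqrt_generic[OF D0]) (auto simp: field_simps real_sqrt_mult[symmetric])
    from DERIV_chain2[OF this D] D0 show ?thesis
      by (simp add: field_simps)
  qed
  have y: "(?y has_vector_derivative - \<mu>') (at t within T)"
    by (auto intro!: derivative_eq_intros \<mu>)
  have Py: "((\<lambda>s. ?P s *v ?y s) has_vector_derivative ?P t *v (- \<mu>') + P' *v ?y t) (at t within T)"
    by (rule bounded_bilinear.has_vector_derivative[OF bounded_bilinear_matrix_vector_mult P y])
  have "(E has_vector_derivative ?y t \<bullet> (?P t *v (- \<mu>') + P' *v ?y t) + (- \<mu>') \<bullet> (?P t *v ?y t))
      (at t within T)"
    unfolding E_def by (rule bounded_bilinear.has_vector_derivative[OF bounded_bilinear_inner y Py])
  \<comment> \<open>Symmetry of the precision makes the two terms in \<open>\<mu>'\<close> equal;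
    the resulting factor 2 cancels the 1/2 in the exponent.\<close>
  moreover have "?y t \<bullet> (?P t *v (- \<mu>') + P' *v ?y t) + (- \<mu>') \<bullet> (?P t *v ?y t) =
      ?y t \<bullet> (P' *v ?y t) - 2 * ((?P t *v ?y t) \<bullet> \<mu>')"
    unfolding inner_add_right inner_symmetric_matrix[OF transpose_matrix_inv[OF inv[OF t] sym], of "?y t" "- \<mu>'"]
    by (simp only: inner_minus_left inner_minus_right inner_commute[of "\<mu>'"])
  ultimately have E: "(E has_real_derivative ?y t \<bullet> (P' *v ?y t) - 2 * ((?P t *v ?y t) \<bullet> \<mu>')) (at t within T)"
    by (metis has_real_derivative_iff_has_vector_derivative)
  have "((\<lambda>s. sqrt (D s) / N * exp (- (1/2) * E s)) has_real_derivative
     sqrt (D t) / N * exp (- (1/2) * E t) *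
       (trace (\<Sigma> t ** P') / 2 + (?P t *v ?y t) \<bullet> \<mu>' - ?y t \<bullet> (P' *v ?y t) / 2)) (at t within T)"
    by (rule derivative_eq_intros sqrt_D E refl N)+ (simp add: N field_simps)
  then have "((\<lambda>s. gaussian_density (\<mu> s) (\<Sigma> s) x) has_real_derivative
     sqrt (D t) / N * exp (- (1/2) * E t) *
       (trace (\<Sigma> t ** P') / 2 + (?P t *v ?y t) \<bullet> \<mu>' - ?y t \<bullet> (P' *v ?y t) / 2)) (at t within T)"
    by (rule has_field_derivative_transform_within[OF _ zero_less_one t])
       (simp add: gaussian_density_precision[OF inv] D_def E_def N_def)
  moreover have "gaussian_density (\<mu> t) (\<Sigma> t) x = sqrt (D t) / N * exp (- (1/2) * E t)"
    using gaussian_density_precision[OF inv[OF t]] by (simp add: D_def E_def N_def)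
  ultimately show ?thesis by metis
qed

text \<open>The spatial gradient is \<open>- q P y\<close>: by symmetry of the precision both halves
  of the product rule for the quadratic form agree.\<close>

lemma has_derivative_gaussian_density:
  fixes \<Sigma> :: "real^'n^'n"
  assumes inv: "invertible \<Sigma>" and sym: "transpose \<Sigma> = \<Sigma>"
  shows "(gaussian_density \<mu> \<Sigma> has_derivative
     (\<lambda>h. - (gaussian_density \<mu> \<Sigma> x * ((matrix_inv \<Sigma> *v (x - \<mu>)) \<bullet> h)))) (at x)"
proof -
  let ?P = "matrix_inv \<Sigma>"
  have y: "((\<lambda>y. y - \<mu>) has_derivative (\<lambda>h. h)) (at x)"
    by (auto intro!: derivative_eq_intros)
  have "((\<lambda>y. (y - \<mu>) \<bullet> (?P *v (y - \<mu>))) has_derivative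
      (\<lambda>h. (x - \<mu>) \<bullet> (?P *v h) + h \<bullet> (?P *v (x - \<mu>)))) (at x)"
    by (intro has_derivative_inner y bounded_linear.has_derivative[OF matrix_vector_mul_bounded_linear])
  moreover have "(x - \<mu>) \<bullet> (?P *v h) + h \<bullet> (?P *v (x - \<mu>)) = 2 * ((?P *v (x - \<mu>)) \<bullet> h)" for h
    using inner_symmetric_matrix[OF transpose_matrix_inv[OF inv sym], of "x - \<mu>" h]
    by (simp add: inner_commute)
  ultimately have E: "((\<lambda>y. (y - \<mu>) \<bullet> (?P *v (y - \<mu>))) has_derivative
      (\<lambda>h. 2 * ((?P *v (x - \<mu>)) \<bullet> h))) (at x)"
    by simp
  show ?thesis
    unfolding gaussian_density_def divide_inverse
    by (rule derivative_eq_intros E refl)+ (simp add: fun_eq_iff)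
qed

section \<open>The divergence of a scalar function times an affine field\<close>

lemma divergence_eq:
  assumes "(F has_derivative F') (at x)"
  shows "divergence F x = (\<Sum>i\<in>UNIV. F' (axis i 1) $ i)"
  using frechet_derivative_at[OF assms]
  by (simp add: divergence_def trace_def jacobian_def matrix_def)

text \<open>The product rule for the divergence, with \<open>g\<close> as the gradient of
  \<open>f\<close> and \<open>trace A\<close> as the divergence of the affine field.\<close>

lemma divergence_scaleR_affine:
  fixes A :: "real^'n^'n"
  assumes "(f has_derivative (\<lambda>h. g \<bullet> h)) (at x)"
  shows "divergence (\<lambda>y. f y *\<^sub>R (A *v y + b)) x = f x * trace A + g \<bullet> (A *v x + b)"
proof -
  have "((\<lambda>y. A *v y + b) has_derivative (\<lambda>h. A *v h)) (at x)"
    by (auto intro!: derivative_eq_intros bounded_linear_imp_has_derivative)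
  from has_derivative_scaleR[OF assms this]
  have "divergence (\<lambda>y. f y *\<^sub>R (A *v y + b)) x =
      (\<Sum>i\<in>UNIV. (f x *\<^sub>R (A *v axis i 1) + (g \<bullet> axis i 1) *\<^sub>R (A *v x + b)) $ i)"
    by (rule divergence_eq)
  also have "\<dots> = (\<Sum>i\<in>UNIV. f x * A $ i $ i + g $ i * (A *v x + b) $ i)"
    by (simp add: matrix_vector_mult_basis column_def inner_axis)
  also have "\<dots> = f x * trace A + g \<bullet> (A *v x + b)"
    by (simp add: sum.distrib trace_def sum_distrib_left inner_vec_def)
  finally show ?thesis .
qed

section \<open>The Liouville equation along the flow\<close>

theorem proposition7:
  fixes K :: nat
    and T :: "real set"
    and \<pi> :: "real \<Rightarrow> nat \<Rightarrow> real"
    and \<mu> :: "real \<Rightarrow> nat \<Rightarrow> real^'n"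
    and \<Sigma> :: "real \<Rightarrow> nat \<Rightarrow> real^'n^'n"
    and \<gamma> :: "real \<Rightarrow> nat \<Rightarrow> real^'n"
    and \<Gamma> :: "real \<Rightarrow> nat \<Rightarrow> real^'n^'n"
    and \<eta>\<omega> :: "real \<Rightarrow> nat \<Rightarrow> real"
    and p :: "real^'n \<Rightarrow> 'z \<Rightarrow> real"
    and lik :: "'z \<Rightarrow> real^'n \<Rightarrow> real"
    and prior :: "real^'n \<Rightarrow> real"
    and z :: 'z
    and V :: "real \<Rightarrow> real^'n \<Rightarrow> real"
    and q :: "real \<Rightarrow> nat \<Rightarrow> real^'n \<Rightarrow> real"
    and Q :: "real \<Rightarrow> nat \<Rightarrow> (real^'n) measure"
    and A :: "real \<Rightarrow> nat \<Rightarrow> real^'n^'n"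
    and b :: "real \<Rightarrow> nat \<Rightarrow> real^'n"
    and \<phi> :: "nat \<Rightarrow> real^'n \<Rightarrow> real \<Rightarrow> real^'n"
  assumes K: "1 \<le> K"
    and T: "is_interval T"
    and weights_pos: "\<And>t k. t \<in> T \<Longrightarrow> k \<in> {1..K} \<Longrightarrow> 0 < \<pi> t k"
    and weights_sum: "\<And>t. t \<in> T \<Longrightarrow> (\<Sum>k = 1..K. \<pi> t k) = 1"
    and cov: "\<And>t k. t \<in> T \<Longrightarrow> k \<in> {1..K} \<Longrightarrow> pos_def_matrix (\<Sigma> t k)"
    and natural_\<gamma>: "\<And>t k. t \<in> T \<Longrightarrow> k \<in> {1..K} \<Longrightarrow> \<gamma> t k = matrix_inv (\<Sigma> t k) *v \<mu> t k"
    and natural_\<Gamma>: "\<And>t k. t \<in> T \<Longrightarrow> k \<in> {1..K} \<Longrightarrow> \<Gamma> t k = (- 1 / 2) *\<^sub>R matrix_inv (\<Sigma> t k)"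
    and natural_\<omega>: "\<And>t k. t \<in> T \<Longrightarrow> k \<in> {1..K} \<Longrightarrow> \<eta>\<omega> t k = ln (\<pi> t k / \<pi> t K)"
    and q: "\<And>t k x. q t k x = gaussian_density (\<mu> t k) (\<Sigma> t k) x"
    and Q: "\<And>t k. Q t k = gaussian_measure (\<mu> t k) (\<Sigma> t k)"
    and joint: "\<And>x. p x z = lik z x * prior x"
    and joint_pos: "\<And>x. 0 < p x z"
    and joint_C2: "twice_continuously_differentiable (\<lambda>x. p x z)"
    and V: "\<And>t x. V t x = ln (gaussian_mixture_density K (\<pi> t) (\<mu> t) (\<Sigma> t) x) - ln (p x z)"
    and finite_V: "\<And>t k. t \<in> T \<Longrightarrow> k \<in> {1..K} \<Longrightarrow> integrable (Q t k) (V t)"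
    and finite_grad: "\<And>t k. t \<in> T \<Longrightarrow> k \<in> {1..K} \<Longrightarrow> integrable (Q t k) (gradient (V t))"
    and finite_hess: "\<And>t k. t \<in> T \<Longrightarrow> k \<in> {1..K} \<Longrightarrow> integrable (Q t k) (hessian (V t))"
    and flow_\<gamma>: "\<And>t k. t \<in> T \<Longrightarrow> k \<in> {1..K} \<Longrightarrow>
      ((\<lambda>s. \<gamma> s k) has_vector_derivative
        - (LINT x|Q t k. (1/2) *\<^sub>R (hessian (V t) x *v (matrix_inv (\<Gamma> t k) *v \<gamma> t k)) + gradient (V t) x))
      (at t within T)"
    and flow_\<Gamma>: "\<And>t k. t \<in> T \<Longrightarrow> k \<in> {1..K} \<Longrightarrow>
      ((\<lambda>s. \<Gamma> s k) has_vector_derivative (- 1 / 2) *\<^sub>R (LINT x|Q t k. hessian (V t) x)) (at t within T)"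
    and flow_\<omega>: "\<And>t k. t \<in> T \<Longrightarrow> k \<in> {1..K} \<Longrightarrow>
      ((\<lambda>s. \<eta>\<omega> s k) has_real_derivative (LINT x|Q t K. V t x) - (LINT x|Q t k. V t x)) (at t within T)"
    and A: "\<And>t k. A t k = (1/4) *\<^sub>R (matrix_inv (\<Gamma> t k) ** (LINT x|Q t k. hessian (V t) x))"
    and b: "\<And>t k. b t k = (1/2) *\<^sub>R (matrix_inv (\<Gamma> t k) *v (LINT x|Q t k. gradient (V t) x))
                         + (1/2) *\<^sub>R (A t k *v (matrix_inv (\<Gamma> t k) *v \<gamma> t k))"
    and \<phi>: "\<And>k x t. \<phi> k x t = A t k *v x + b t k"
  shows "\<forall>k\<in>{1..K}. \<forall>t\<in>T. \<forall>x.
    ((\<lambda>s. q s k x) has_real_derivative - divergence (\<lambda>y. q t k y *\<^sub>R \<phi> k y t) x) (at t within T)"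
proof (intro ballI allI)
  fix k t x
  assume k: "k \<in> {1..K}" and t: "t \<in> T"
  define P where "P s = matrix_inv (\<Sigma> s k)" for s
  define H where "H = (LINT x|Q t k. hessian (V t) x)"
  define g where "g = (LINT x|Q t k. gradient (V t) x)"
  have inv: "invertible (\<Sigma> s k)" if "s \<in> T" for s
    using cov[OF that k] by (rule pos_def_matrix_invertible)
  have sym: "transpose (\<Sigma> t k) = \<Sigma> t k"
    using cov[OF t k] by (simp add: pos_def_matrix_def)
  have inv_P: "invertible (P s)" if "s \<in> T" for s
    unfolding P_def by (rule invertible_matrix_inv[OF inv[OF that]])
  have cancel: "P t ** \<Sigma> t k = mat 1" "\<Sigma> t k ** P t = mat 1"
    unfolding P_def using matrix_inv_cancel[OF inv[OF t]] by auto
  have inv_inv: "matrix_inv (P t) = \<Sigma> t k"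
    by (rule matrix_inv_eqI[OF cancel(1)])
  have inv_\<Gamma>: "matrix_inv (\<Gamma> t k) = (-2) *\<^sub>R \<Sigma> t k"
    using cancel(1) by (intro matrix_inv_eqI)
      (simp add: natural_\<Gamma>[OF t k] P_def[symmetric] matrix_mult_scaleR_scaleR del: scaleR_minus_left)
  \<comment> \<open>This identity turns the Hessian term in the flow of \<gamma>, and the last term
    of \<open>b\<close>, into expressions in the mean.\<close>
  have mean: "matrix_inv (\<Gamma> t k) *v \<gamma> t k = (-2) *\<^sub>R \<mu> t k"
  proof -
    have "\<Sigma> t k *v \<gamma> t k = \<mu> t k"
      by (simp add: natural_\<gamma>[OF t k] P_def[symmetric] matrix_vector_mul_assoc cancel(2))
    then show ?thesis
      by (simp add: inv_\<Gamma> scaleR_matrix_vector_assoc[symmetric] del: scaleR_minus_left)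
  qed
  have P: "(P has_vector_derivative H) (at t within T)"
  proof (rule has_vector_derivative_transform[OF t])
    show "((\<lambda>s. (-2) *\<^sub>R \<Gamma> s k) has_vector_derivative H) (at t within T)"
      using bounded_linear.has_vector_derivative[OF bounded_linear_scaleR_right flow_\<Gamma>[OF t k], of "-2"]
      by (simp add: H_def)
    show "P s = (-2) *\<^sub>R \<Gamma> s k" if "s \<in> T" for s
      by (simp add: natural_\<Gamma>[OF that k] P_def)
  qed
  have \<gamma>: "((\<lambda>s. \<gamma> s k) has_vector_derivative H *v \<mu> t k - g) (at t within T)"
  proof -
    \<comment> \<open>The mean does not depend on the integration variable, so multiplication by it
      is a bounded linear map on matrices and commutes with the expectation of the Hessian.\<close>
    note lin = bounded_bilinear.bounded_linear_left[OF bounded_bilinear_matrix_vector_mult, of "\<mu> t k"]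
    have "(LINT x|Q t k. (1/2) *\<^sub>R (hessian (V t) x *v (matrix_inv (\<Gamma> t k) *v \<gamma> t k)) + gradient (V t) x)
        = (LINT x|Q t k. gradient (V t) x - hessian (V t) x *v \<mu> t k)"
      unfolding mean by (simp add: matrix_vector_mult_scaleR del: scaleR_minus_left)
    also have "\<dots> = g - H *v \<mu> t k"
      unfolding g_def H_def
      using finite_grad[OF t k] finite_hess[OF t k]
      by (simp add: integrable_bounded_linear[OF lin] integral_bounded_linear[OF lin])
    finally show ?thesis
      using flow_\<gamma>[OF t k] by simp
  qed
  \<comment> \<open>Applied to P\<mu> = \<gamma>, the linear system lemma gives \<Sigma>(H\<mu> - g
    - H\<mu>), where the Hessian parts cancel.\<close>
  have \<mu>: "((\<lambda>s. \<mu> s k) has_vector_derivative - (\<Sigma> t k *v g)) (at t within T)"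
    using has_vector_derivative_linear_system[OF t P \<gamma> inv_P, of "\<lambda>s. \<mu> s k"]
    by (simp add: natural_\<gamma>[OF _ k] P_def[symmetric] inv_inv vec.neg)
  define y where "y = x - \<mu> t k"
  have A_eq: "A t k = (-1/2) *\<^sub>R (\<Sigma> t k ** H)"
    by (simp add: A inv_\<Gamma> H_def scalar_matrix_assoc[symmetric] del: scaleR_minus_left)
  \<comment> \<open>Recentring at the mean: \<open>b t k\<close> equals -\<Sigma>g - A\<mu>, so the
    constant part absorbs the shift from x to y.\<close>
  have \<phi>_eq: "A t k *v x + b t k = A t k *v y - \<Sigma> t k *v g"
    unfolding b[of t k] mean unfolding inv_\<Gamma> g_def[symmetric] y_def
    by (simp add: matrix_vector_mult_diff_distrib matrix_vector_mult_scaleR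
        scaleR_matrix_vector_assoc[symmetric] del: scaleR_minus_left)
  \<comment> \<open>In the product of \<nabla>q with the particle dynamics, the precision from the
    gradient cancels the covariance standing in front of both H and g.\<close>
  have P\<Sigma>: "(P t *v y) \<bullet> (\<Sigma> t k *v u) = y \<bullet> u" for u
  proof -
    have "(P t *v y) \<bullet> (\<Sigma> t k *v u) = y \<bullet> (P t *v (\<Sigma> t k *v u))"
      unfolding P_def by (rule inner_symmetric_matrix[OF transpose_matrix_inv[OF inv[OF t] sym], symmetric])
    then show ?thesis
      by (simp add: matrix_vector_mul_assoc cancel(1))
  qed
  have "(q t k has_derivative (\<lambda>h. (- q t k x *\<^sub>R (P t *v y)) \<bullet> h)) (at x)"
    using has_derivative_gaussian_density[OF inv[OF t] sym]
    by (simp add: q[abs_def] P_def y_def)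
  then have "divergence (\<lambda>y. q t k y *\<^sub>R \<phi> k y t) x =
      q t k x * trace (A t k) + (- q t k x *\<^sub>R (P t *v y)) \<bullet> (A t k *v x + b t k)"
    unfolding \<phi> by (rule divergence_scaleR_affine)
  \<comment> \<open>The term y\<bullet>g is kept as an inner product with -\<Sigma>g so that the
    bracket is exactly the parameter derivative for mean velocity -\<Sigma>g and precision velocity
    H.\<close>
  also have "\<dots> = - (q t k x * (trace (\<Sigma> t k ** H) / 2 + (P t *v y) \<bullet> (- (\<Sigma> t k *v g)) - y \<bullet> (H *v y) / 2))"
    unfolding \<phi>_eq unfolding A_eq
    by (simp add: trace_scaleR P\<Sigma> inner_diff_right scaleR_matrix_vector_assoc[symmetric]
        matrix_vector_mul_assoc[symmetric] algebra_simps del: scaleR_minus_left)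
  finally have div: "- divergence (\<lambda>y. q t k y *\<^sub>R \<phi> k y t) x =
      q t k x * (trace (\<Sigma> t k ** H) / 2 + (P t *v y) \<bullet> (- (\<Sigma> t k *v g)) - y \<bullet> (H *v y) / 2)"
    by simp
  show "((\<lambda>s. q s k x) has_real_derivative - divergence (\<lambda>y. q t k y *\<^sub>R \<phi> k y t) x) (at t within T)"
    unfolding div unfolding q y_def P_def
    by (rule has_real_derivative_gaussian_density_parameters[OF t inv sym \<mu> P[unfolded P_def]])
qed

end
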